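(* For every $X\in\mathcal{O}^{d,r}$, $\partial_{\mathrm R}|_{\tilde w}w(X)\subseteq\partial_{\mathrm R}w(X)$.
   Context: $1\le r<d$, $\mathcal{O}^{d,r}=\{X\in\mathbb{R}^{d\times r}:X^\top X=I_r\}$ with tangent space $\mathcal{T}_X\mathcal{O}^{d,r}=\{D:X^\top D+D^\top X=0\}$ and orthogonal projection $\mathrm{Proj}_{\mathcal{T}_X}(V)=V-X(X^\top V+V^\top X)/2$. For a function $F$ smooth near $X$, the Riemannian gradient is $\mathrm{grad}\,F(X)=\mathrm{Proj}_{\mathcal{T}_X}(\nabla F(X))$. For a locally Lipschitz $F:\mathcal{O}^{d,r}\to\mathbb{R}$, with $\Omega(F)$ the set of points where $F$ is differentiable, the Riemannian Clarke subdifferential is $\partial_{\mathrm R}F(X)=\mathrm{conv}\{D\in\mathcal{T}_X\mathcal{O}^{d,r}:\mathrm{grad}\,F(X_t)\to D\text{ for some }\Omega(F)\ni X_t\to X\}$. Fix $\Sigma_\circ\in\mathbb{S}_+^d$, $\rho>0$, $w(X)=2\rho\|(I_d-XX^\top)\Sigma_\circ^{1/2}\|_{\mathrm F}$, and the smoothing function $\tilde w(X,\mu)=w(X)$ if $w(X)\ge\mu\rho$, $\tilde w(X,\mu)=\frac{w(X)^2}{2\mu\rho}+\frac{\mu\rho}{2}$ if $w(X)<\mu\rho$ ($\mu>0$). Writing $\mathrm{grad}\,\tilde w(X,\mu)$ for the Riemannian gradient of $\tilde w(\cdot,\mu)$, the smoothing subdifferential is $\partial_{\mathrm R}|_{\tilde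 w}w(X)=\{G\in\mathcal{T}_X\mathcal{O}^{d,r}:\mathrm{grad}\,\tilde w(X_t,\mu_t)\to G\text{ for some sequences }\mathcal{O}^{d,r}\ni X_t\to X,\ \mu_t\downarrow 0\}$. *)

theory Defs
  imports "HOL-Analysis.Analysis"
begin

text \<open>Matrices X in R^{d x r} are rendered as real^'r^'d (d rows, r columns).
  The inner product on real^'r^'d is the Frobenius inner product and norm is the
  Frobenius norm.\<close>

definition stiefel :: "(real^'r^'d) set" where
  "stiefel = {X. transpose X ** X = mat 1}"

definition tangent_space :: "real^'r^'d \<Rightarrow> (real^'r^'d) set" where
  "tangent_space X = {D. transpose X ** D + transpose D ** X = 0}"

definition proj_tangent :: "real^'r^'d \<Rightarrow> real^'r^'d \<Rightarrow> real^'r^'d" where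
  "proj_tangent X V = V - X ** ((1/2) *\<^sub>R (transpose X ** V + transpose V ** X))"

text \<open>G is the Riemannian gradient of F at X (F viewed as a function on the embedded
  submanifold stiefel): G is tangent and F(Y) = F(X) + <G, Y - X> + o(|Y - X|) for Y on
  the manifold. For F smooth near X in the ambient space this G equals
  proj_tangent X (ambient gradient).\<close>

definition has_rgrad :: "(real^'r^'d \<Rightarrow> real) \<Rightarrow> real^'r^'d \<Rightarrow> real^'r^'d \<Rightarrow> bool" where
  "has_rgrad F X G \<longleftrightarrow> G \<in> tangent_space X \<and>
     (F has_derivative (\<lambda>D. G \<bullet> D)) (at X within stiefel)"

definition rdiff_points :: "(real^'r^'d \<Rightarrow> real) \<Rightarrow> (real^'r^'d) set" where
  "rdiff_points F = {X \<in> stiefel. \<exists>G. has_rgrad F X G}"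

definition rgrad :: "(real^'r^'d \<Rightarrow> real) \<Rightarrow> real^'r^'d \<Rightarrow> real^'r^'d" where
  "rgrad F X = (THE G. has_rgrad F X G)"

definition clarke_subdiff :: "(real^'r^'d \<Rightarrow> real) \<Rightarrow> real^'r^'d \<Rightarrow> (real^'r^'d) set" where
  "clarke_subdiff F X = convex hull
     {D \<in> tangent_space X. \<exists>Xs :: nat \<Rightarrow> real^'r^'d.
        (\<forall>t. Xs t \<in> rdiff_points F) \<and> Xs \<longlonglongrightarrow> X \<and>
        (\<lambda>t. rgrad F (Xs t)) \<longlonglongrightarrow> D}"

definition psd :: "real^'n^'n \<Rightarrow> bool" where
  "psd S \<longleftrightarrow> transpose S = S \<and> (\<forall>v. 0 \<le> v \<bullet> (S *v v))"

definition psd_sqrt :: "real^'n^'n \<Rightarrow> real^'n^'n" where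
  "psd_sqrt S = (THE R. psd R \<and> R ** R = S)"

definition wfun :: "real^'d^'d \<Rightarrow> real \<Rightarrow> real^'r^'d \<Rightarrow> real" where
  "wfun S0 \<rho> X = 2 * \<rho> * norm ((mat 1 - X ** transpose X) ** psd_sqrt S0)"

definition wtilde :: "real^'d^'d \<Rightarrow> real \<Rightarrow> real^'r^'d \<Rightarrow> real \<Rightarrow> real" where
  "wtilde S0 \<rho> X \<mu> =
     (if wfun S0 \<rho> X \<ge> \<mu> * \<rho> then wfun S0 \<rho> X
      else (wfun S0 \<rho> X)\<^sup>2 / (2 * \<mu> * \<rho>) + \<mu> * \<rho> / 2)"

definition smoothing_subdiff ::
  "(real^'r^'d \<Rightarrow> real \<Rightarrow> real) \<Rightarrow> real^'r^'d \<Rightarrow> (real^'r^'d) set" where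
  "smoothing_subdiff Ft X =
     {G \<in> tangent_space X. \<exists>(Xs :: nat \<Rightarrow> real^'r^'d) (\<mu>s :: nat \<Rightarrow> real).
        (\<forall>t. Xs t \<in> stiefel) \<and> Xs \<longlonglongrightarrow> X \<and>
        (\<forall>t. 0 < \<mu>s t) \<and> decseq \<mu>s \<and> \<mu>s \<longlonglongrightarrow> 0 \<and>
        (\<lambda>t. rgrad (\<lambda>Y. Ft Y (\<mu>s t)) (Xs t)) \<longlonglongrightarrow> G}"

end

theory Submission
  imports Defs
begin

text \<open>
  Write \<open>M(X) = (I - X X\<^sup>T) R\<close> with \<open>R = \<Sigma>\<^sup>1\<^sup>/\<^sup>2\<close>, so \<open>w = 2 \<rho> |M|\<close>. Where \<open>w > 0\<close> the Riemannian gradient is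
  \<open>g(X) = - (2 \<rho> / |M|) M R\<^sup>T X\<close>, and the gradient of the smoothing is \<open>min 1 (w / (\<mu> \<rho>)) g\<close> (zero where
  \<open>w = 0\<close>). If \<open>w(X) > 0\<close>, the factor is eventually 1. If \<open>w(X) = 0\<close>, a limit of smoothed gradients
  is \<open>\<kappa> D\<close> with \<open>0 \<le> \<kappa> \<le> 1\<close> and \<open>D\<close> a limit of gradients of \<open>w\<close>, so it suffices that \<open>-D\<close> is such a
  limit as well. The reflection \<open>Q = 2 X X\<^sup>T - I\<close> fixes \<open>X\<close> and, because \<open>M(X) = 0\<close>, also \<open>R\<close>; hence
  \<open>w\<close> is invariant under \<open>Q\<close>, and \<open>Q D = -D\<close> since \<open>X\<^sup>T D = 0\<close>.
  If \<open>w\<close> vanishes near \<open>X\<close>, there is no such \<open>D\<close>, but then \<open>0\<close> is itself the gradient of \<open>w\<close> at \<open>X\<close>.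
\<close>

section \<open>Matrix products, transposes and the Frobenius inner product\<close>

lemma bounded_bilinear_matrix_matrix_mult:
  "bounded_bilinear ((**) :: real^'n^'m \<Rightarrow> real^'p^'n \<Rightarrow> real^'p^'m)"
  unfolding bilinear_conv_bounded_bilinear[symmetric] bilinear_def
  by (auto intro!: linearI simp: matrix_matrix_mult_def vec_eq_iff algebra_simps
      sum.distrib sum_distrib_left)

interpretation mm: bounded_bilinear "(**) :: real^'n^'m \<Rightarrow> real^'p^'n \<Rightarrow> real^'p^'m"
  by (rule bounded_bilinear_matrix_matrix_mult)

lemma bounded_linear_transpose:
  "bounded_linear (transpose :: real^'n^'m \<Rightarrow> real^'m^'n)"
  unfolding linear_conv_bounded_linear[symmetric]
  by (auto intro!: linearI simp: transpose_def vec_eq_iff)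

lemmas transpose_add = linear_add[OF bounded_linear.linear[OF bounded_linear_transpose]]
lemmas transpose_zero = linear_0[OF bounded_linear.linear[OF bounded_linear_transpose]]
lemmas transpose_diff = linear_diff[OF bounded_linear.linear[OF bounded_linear_transpose]]

lemma inner_matrix_mult_left:
  fixes A :: "real^'p^'m" and B :: "real^'n^'m" and C :: "real^'p^'n"
  shows "A \<bullet> (B ** C) = (transpose B ** A) \<bullet> C"
proof -
  have "A \<bullet> (B ** C) = (\<Sum>i\<in>UNIV. \<Sum>j\<in>UNIV. \<Sum>k\<in>UNIV. A$i$j * (B$i$k * C$k$j))"
    by (simp add: inner_vec_def matrix_matrix_mult_def sum_distrib_left)
  also have "\<dots> = (\<Sum>i\<in>UNIV. \<Sum>k\<in>UNIV. \<Sum>j\<in>UNIV. A$i$j * (B$i$k * C$k$j))"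
    by (rule sum.cong[OF refl], rule sum.swap)
  also have "\<dots> = (\<Sum>k\<in>UNIV. \<Sum>i\<in>UNIV. \<Sum>j\<in>UNIV. A$i$j * (B$i$k * C$k$j))"
    by (rule sum.swap)
  also have "\<dots> = (\<Sum>k\<in>UNIV. \<Sum>j\<in>UNIV. \<Sum>i\<in>UNIV. A$i$j * (B$i$k * C$k$j))"
    by (rule sum.cong[OF refl], rule sum.swap)
  also have "\<dots> = (transpose B ** A) \<bullet> C"
    by (simp add: inner_vec_def matrix_matrix_mult_def transpose_def sum_distrib_left mult_ac)
  finally show ?thesis .
qed

lemma inner_transpose_transpose:
  fixes A B :: "real^'n^'m"
  shows "transpose A \<bullet> transpose B = A \<bullet> B"
  by (simp add: inner_vec_def transpose_def, rule sum.swap)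

lemma inner_matrix_mult_right:
  fixes A :: "real^'p^'m" and B :: "real^'n^'m" and C :: "real^'p^'n"
  shows "A \<bullet> (B ** C) = (A ** transpose C) \<bullet> B"
proof -
  have "A \<bullet> (B ** C) = transpose A \<bullet> (transpose C ** transpose B)"
    by (simp add: inner_transpose_transpose flip: matrix_transpose_mul)
  also have "\<dots> = transpose (A ** transpose C) \<bullet> transpose B"
    by (simp add: inner_matrix_mult_left matrix_transpose_mul)
  finally show ?thesis by (simp add: inner_transpose_transpose)
qed

section \<open>Curves in the Stiefel manifold and uniqueness of the Riemannian gradient\<close>

text \<open>The Cayley transform of a skew matrix is orthogonal, so it moves \<open>X\<close> within
  the manifold. Every tangent direction is thus reached up to a quadratic error, which lets a
  derivative taken only within \<open>stiefel\<close> determine a tangent gradient.\<close>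

lemma stiefel_cayley_curve:
  fixes X D :: "real^'r^'d"
  assumes X: "X \<in> stiefel" and D: "D \<in> tangent_space X"
  obtains C where "C \<ge> 0"
    "\<And>t. \<exists>Z. X + Z \<in> stiefel \<and> norm Z \<le> \<bar>t\<bar> * norm D \<and> norm (Z - t *\<^sub>R D) \<le> C * t\<^sup>2"
proof -
  have XX: "transpose X ** X = mat 1" using X by (simp add: stiefel_def)
  \<comment> \<open>The curve solves \<open>(I - t W / 2) Z = t D\<close> for the skew \<open>W\<close> with \<open>W X = D\<close> (Cayley transform).\<close>
  define A where "A = transpose X ** D"
  have A: "transpose D ** X = - A"
    using D by (simp add: tangent_space_def A_def eq_neg_iff_add_eq_0 add.commute)
  \<comment> \<open>The first two terms send \<open>X\<close> to \<open>D + X ** A\<close>. The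
    third removes the excess and is itself skew because \<open>A\<close> is.\<close>
  define W where "W = D ** transpose X - X ** transpose D - X ** A ** transpose X"
  have WX: "W ** X = D"
    by (simp add: W_def mm.diff_left mm.minus_right matrix_mul_assoc[symmetric] XX A)
  have tA: "transpose A = - A"
    using A by (simp add: A_def matrix_transpose_mul)
  have W: "transpose W = - W"
    by (simp add: W_def transpose_diff tA matrix_transpose_mul mm.minus_right mm.minus_left matrix_mul_assoc)
  have skew: "Z \<bullet> (W ** Z) = 0" for Z :: "real^'r^'d"
  proof -
    have "Z \<bullet> (W ** Z) = - (Z \<bullet> (W ** Z))"
      by (subst inner_matrix_mult_left) (simp add: W mm.minus_left inner_commute)
    then show ?thesis by simp
  qed
  have "\<exists>K>0. \<forall>(a :: real^'d^'d) (b :: real^'r^'d). norm (a ** b) \<le> norm a * norm b * K"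
    by (rule mm.pos_bounded)
  then obtain K where K: "K > 0"
    "norm (a ** b) \<le> norm a * norm b * K" for a :: "real^'d^'d" and b :: "real^'r^'d"
    by metis
  show ?thesis
  proof
    show "0 \<le> norm W * norm D * K / 2" using K(1) by simp
    fix t :: real
    define L where "L = (\<lambda>Z :: real^'r^'d. Z - (t/2) *\<^sub>R (W ** Z))"
    \<comment> \<open>By skewness the correction \<open>W ** Z\<close> is orthogonal to
      \<open>Z\<close>, so \<open>L\<close> never shrinks norms. This yields both the solvability of
      \<open>L Z = t *\<^sub>R D\<close> and the bound on \<open>Z\<close>.\<close>
    have lower: "norm Z \<le> norm (L Z)" for Z
    proof -
      have "(norm Z)\<^sup>2 = Z \<bullet> L Z"
        by (simp add: L_def inner_diff_right skew power2_norm_eq_inner)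
      also have "\<dots> \<le> norm Z * norm (L Z)"
        by (rule norm_cauchy_schwarz)
      finally show ?thesis by (cases "Z = 0") (simp_all add: power2_eq_square)
    qed
    have lin: "linear L"
      by (auto intro!: linearI simp: L_def mm.add_right mm.scaleR_right algebra_simps)
    have "inj L"
      using lower lin by (metis linear_injective_0 norm_le_zero_iff norm_zero)
    then have "surj L" using lin linear_injective_imp_surjective by blast
    then obtain Z where Z: "L Z = t *\<^sub>R D" by (metis surjD)
    have nZ: "norm Z \<le> \<bar>t\<bar> * norm D" using lower[of Z] Z by simp
    \<comment> \<open>\<open>M\<close> is the midpoint between \<open>X\<close> and
      \<open>X + Z\<close>. The change of the Gram matrix along the step is
      \<open>transpose M ** Z + transpose Z ** M\<close>, which vanishes since \<open>Z\<close> is a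
      multiple of \<open>W ** M\<close> with \<open>W\<close> skew.\<close>
    define M where "M = X + (1/2) *\<^sub>R Z"
    have ZM: "Z = t *\<^sub>R (W ** M)"
      using Z by (simp add: L_def M_def mm.add_right mm.scaleR_right WX algebra_simps)
    have half: "(1/2) *\<^sub>R P + (1/2) *\<^sub>R P = P" for P :: "real^'r^'r"
      by (simp flip: scaleR_add_left)
    have "transpose M ** Z + transpose Z ** M = transpose X ** Z + transpose Z ** X
        + ((1/2) *\<^sub>R (transpose Z ** Z) + (1/2) *\<^sub>R (transpose Z ** Z))"
      by (simp add: M_def transpose_add transpose_scalar mm.add_right mm.add_left mm.scaleR_right
          mm.scaleR_left add_ac)
    then have "transpose (X + Z) ** (X + Z) = mat 1 + (transpose M ** Z + transpose Z ** M)"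
      unfolding half by (simp add: transpose_add mm.add_right mm.add_left XX add_ac)
    also have "transpose M ** Z + transpose Z ** M = 0"
      by (subst (1 2) ZM)
        (simp add: transpose_scalar matrix_transpose_mul W mm.minus_left mm.minus_right mm.scaleR_right
          mm.scaleR_left matrix_mul_assoc)
    finally have "X + Z \<in> stiefel" by (simp add: stiefel_def)
    moreover have "norm (Z - t *\<^sub>R D) \<le> norm W * norm D * K / 2 * t\<^sup>2"
    proof -
      have "Z - t *\<^sub>R D = (t/2) *\<^sub>R (W ** Z)" using Z by (simp add: L_def algebra_simps)
      then have "norm (Z - t *\<^sub>R D) = \<bar>t\<bar>/2 * norm (W ** Z)" by simp
      also have "\<dots> \<le> \<bar>t\<bar>/2 * (norm W * norm Z * K)"
        by (intro mult_left_mono K) auto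
      also have "\<dots> \<le> \<bar>t\<bar>/2 * (norm W * (\<bar>t\<bar> * norm D) * K)"
        using K(1) by (intro mult_left_mono mult_right_mono nZ) auto
      also have "\<dots> = norm W * norm D * K / 2 * \<bar>t\<bar>\<^sup>2" by (simp add: power2_eq_square mult_ac)
      finally show ?thesis by simp
    qed
    ultimately show "\<exists>Z. X + Z \<in> stiefel \<and> norm Z \<le> \<bar>t\<bar> * norm D
        \<and> norm (Z - t *\<^sub>R D) \<le> norm W * norm D * K / 2 * t\<^sup>2"
      using nZ by blast
  qed
qed

lemma subspace_tangent_space: "subspace (tangent_space X)"
proof -
  have "linear (\<lambda>D. transpose X ** D + transpose D ** X)"
    by (intro linearI) (simp_all add: mm.add_right mm.add_left transpose_add transpose_scalar
      mm.scaleR_right mm.scaleR_left scaleR_add_right)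
  then show ?thesis unfolding tangent_space_def by (rule linear_subspace_kernel)
qed

text \<open>The difference \<open>H\<close> of two gradients is tangent, while its pairing with
  displacements along the manifold is of smaller order than their length. Testing with a curve in
  the direction \<open>H\<close> itself contradicts \<open>H \<noteq> 0\<close>. This makes the
  description in \<open>rgrad\<close> meaningful.\<close>

lemma has_rgrad_unique:
  fixes X :: "real^'r^'d"
  assumes X: "X \<in> stiefel" and G1: "has_rgrad F X G1" and G2: "has_rgrad F X G2"
  shows "G1 = G2"
proof (rule ccontr)
  assume neq: "G1 \<noteq> G2"
  define H where "H = G1 - G2"
  have H0: "norm H > 0" using neq by (simp add: H_def)
  have "H \<in> tangent_space X"
    using G1 G2 by (simp add: H_def has_rgrad_def subspace_diff subspace_tangent_space)
  then obtain C where C: "C \<ge> 0"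
    "\<And>t. \<exists>Z. X + Z \<in> stiefel \<and> norm Z \<le> \<bar>t\<bar> * norm H \<and> norm (Z - t *\<^sub>R H) \<le> C * t\<^sup>2"
    using stiefel_cayley_curve[OF X] by blast
  have "((\<lambda>Y. F Y - F Y) has_derivative (\<lambda>D. G1 \<bullet> D - G2 \<bullet> D)) (at X within stiefel)"
    using G1 G2 unfolding has_rgrad_def by (intro has_derivative_diff) auto
  then have "((\<lambda>Y. 0) has_derivative (\<lambda>D. H \<bullet> D)) (at X within stiefel)"
    by (simp add: H_def inner_diff_left)
  then obtain d where d: "d > 0" "\<And>Y. Y \<in> stiefel \<Longrightarrow> norm (Y - X) < d \<Longrightarrow>
      \<bar>H \<bullet> (Y - X)\<bar> \<le> (norm H / 4) * norm (Y - X)"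
    unfolding has_derivative_within_alt using H0
    by (auto dest!: spec[of _ "norm H / 4"])
  \<comment> \<open>The first bound puts the curve point at distance at most \<open>d / 2\<close>
    from \<open>X\<close>; the second keeps the curvature error \<open>C * t\<close> below
    \<open>norm H / 4\<close>, with \<open>C + 1\<close> avoiding a division by zero. Each of the
    two errors then costs at most a quarter of \<open>t * (norm H)\<^sup>2\<close>.\<close>
  define t where "t = min (d / (2 * norm H)) (norm H / (4 * (C + 1)))"
  have t: "t > 0" using d(1) H0 C(1) by (simp add: t_def)
  have "t * norm H \<le> d / (2 * norm H) * norm H"
    by (intro mult_right_mono) (auto simp: t_def)
  then have t1: "t * norm H < d" using d(1) H0 by simp
  have "C * t \<le> (C + 1) * (norm H / (4 * (C + 1)))"
    using C(1) t by (intro mult_mono) (auto simp: t_def)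
  also have "\<dots> = norm H / 4" using C(1) by (simp add: field_simps)
  finally have t2: "C * t \<le> norm H / 4" .
  obtain Z where Z: "X + Z \<in> stiefel" "norm Z \<le> t * norm H" "norm (Z - t *\<^sub>R H) \<le> C * t\<^sup>2"
    using C(2)[of t] t by auto
  have "\<bar>H \<bullet> Z\<bar> \<le> norm H / 4 * norm Z" using d(2)[OF Z(1)] Z(2) t1 by simp
  also have "\<dots> \<le> norm H / 4 * (t * norm H)" by (intro mult_left_mono Z) auto
  finally have 1: "\<bar>H \<bullet> Z\<bar> \<le> t * (norm H)\<^sup>2 / 4" by (simp add: power2_eq_square mult_ac)
  have "H \<bullet> Z - t * (norm H)\<^sup>2 = H \<bullet> (Z - t *\<^sub>R H)"
    by (simp add: inner_diff_right power2_norm_eq_inner)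
  also have "\<bar>\<dots>\<bar> \<le> norm H * norm (Z - t *\<^sub>R H)" by (rule Cauchy_Schwarz_ineq2)
  also have "\<dots> \<le> norm H * (C * t\<^sup>2)" by (intro mult_left_mono Z) auto
  also have "\<dots> = norm H * t * (C * t)" by (simp add: power2_eq_square)
  also have "\<dots> \<le> norm H * t * (norm H / 4)" using t by (intro mult_left_mono t2) auto
  finally have 2: "\<bar>H \<bullet> Z - t * (norm H)\<^sup>2\<bar> \<le> t * (norm H)\<^sup>2 / 4"
    by (simp add: power2_eq_square mult_ac)
  have "t * (norm H)\<^sup>2 > 0" using t H0 by simp
  then show False using 1 2 by linarith
qed

lemma rgrad_eqI: "X \<in> stiefel \<Longrightarrow> has_rgrad F X G \<Longrightarrow> rgrad F X = G"
  unfolding rgrad_def by (blast intro: the_equality has_rgrad_unique)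

section \<open>The residual and the Riemannian gradient of its norm\<close>

definition resid :: "real^'d^'d \<Rightarrow> real^'r^'d \<Rightarrow> real^'d^'d" where
  "resid R X = (mat 1 - X ** transpose X) ** R"

text \<open>Where \<open>resid R X = 0\<close>, division by zero makes \<open>wgrad c R X = 0\<close>, the value needed in \<open>has_rgrad_huber\<close>.\<close>

definition wgrad :: "real \<Rightarrow> real^'d^'d \<Rightarrow> real^'r^'d \<Rightarrow> real^'r^'d" where
  "wgrad c R X = (- c / norm (resid R X)) *\<^sub>R (resid R X ** (transpose R ** X))"

lemma wfun_resid: "wfun S0 \<rho> X = 2 * \<rho> * norm (resid (psd_sqrt S0) X)"
  by (simp add: wfun_def resid_def)

lemma resid_has_derivative:
  "(resid R has_derivative (\<lambda>D. - (X ** transpose D + D ** transpose X) ** R)) (at X within S)"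
proof -
  have "((\<lambda>Y. Y ** transpose Y) has_derivative (\<lambda>D. X ** transpose D + D ** transpose X))
      (at X within S)"
    by (intro mm.FDERIV bounded_linear.has_derivative[OF bounded_linear_transpose] has_derivative_ident)
  then have "((\<lambda>Y. mat 1 - Y ** transpose Y) has_derivative (\<lambda>D. 0 - (X ** transpose D + D ** transpose X)))
      (at X within S)"
    by (intro has_derivative_diff has_derivative_const)
  from bounded_linear.has_derivative[OF mm.bounded_linear_left this, of R] show ?thesis
    by (simp add: resid_def [abs_def])
qed

lemma continuous_on_resid: "continuous_on S (resid R)"
  by (rule has_derivative_continuous_on[OF resid_has_derivative])

lemma transpose_mult_resid:
  assumes "X \<in> stiefel" shows "transpose X ** resid R X = 0"
proof -
  have "transpose X ** (mat 1 - X ** transpose X) = 0"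
    using assms by (simp add: stiefel_def mm.diff_right matrix_mul_assoc)
  then show ?thesis by (simp add: resid_def matrix_mul_assoc)
qed

text \<open>The columns of \<open>resid R X\<close> are orthogonal to those of \<open>X\<close>.
  This is stronger than tangency, and the reflection argument relies on the stronger form.\<close>

lemma transpose_mult_wgrad: "X \<in> stiefel \<Longrightarrow> transpose X ** wgrad c R X = 0"
  by (simp add: wgrad_def mm.scaleR_right mm.minus_right matrix_mul_assoc transpose_mult_resid)

lemma tangent_spaceI:
  assumes "transpose X ** D = 0" shows "D \<in> tangent_space X"
proof -
  have "transpose D ** X = transpose (transpose X ** D)" by (simp add: matrix_transpose_mul)
  then show ?thesis using assms by (simp add: tangent_space_def transpose_zero)
qed

text \<open>In the derivative of \<open>X ** transpose X\<close>, the term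
  \<open>X ** transpose D\<close> is orthogonal to the residual and drops out. Moving the other
  factors across the inner product leaves \<open>wgrad\<close>, which is already tangent, so no
  projection appears.\<close>

lemma has_rgrad_norm_resid:
  assumes X: "X \<in> stiefel" and nz: "resid R X \<noteq> 0"
  shows "has_rgrad (\<lambda>Y. c * norm (resid R Y)) X (wgrad c R X)"
proof -
  let ?M = "resid R X"
  have "(norm has_derivative (\<lambda>h. sgn ?M \<bullet> h)) (at ?M)"
    using has_derivative_norm[OF nz] by (simp add: inner_commute)
  then have d: "((\<lambda>Y. c * norm (resid R Y)) has_derivative
     (\<lambda>D. c * (sgn ?M \<bullet> (- (X ** transpose D + D ** transpose X) ** R)))) (at X within stiefel)"
    by (intro has_derivative_mult_right has_derivative_compose[OF resid_has_derivative])
  have "c * (sgn ?M \<bullet> (- (X ** transpose D + D ** transpose X) ** R)) = wgrad c R X \<bullet> D" for D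
  proof -
    have "?M \<bullet> ((X ** transpose D) ** R) = 0"
      by (simp add: matrix_mul_assoc[symmetric] inner_matrix_mult_left transpose_mult_resid X)
    moreover have "?M \<bullet> ((D ** transpose X) ** R) = (?M ** (transpose R ** X)) \<bullet> D"
      by (simp add: matrix_mul_assoc[symmetric])
         (simp add: inner_matrix_mult_right matrix_transpose_mul)
    ultimately have "?M \<bullet> (- (X ** transpose D + D ** transpose X) ** R) =
        - ((?M ** (transpose R ** X)) \<bullet> D)"
      by (simp add: mm.minus_left mm.add_left inner_add_right mm.diff_left inner_diff_right)
    then show ?thesis by (simp add: wgrad_def sgn_div_norm divide_inverse)
  qed
  then show ?thesis
    using d X by (simp add: has_rgrad_def tangent_spaceI transpose_mult_wgrad)
qed

section \<open>The Huber function and the gradient of the smoothing\<close>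

text \<open>For \<open>m > 0\<close> and nonnegative arguments this is the usual Huber function
  raised by \<open>m / 2\<close>.\<close>

definition huber :: "real \<Rightarrow> real \<Rightarrow> real" where
  "huber m s = (if s \<ge> m then s else s\<^sup>2 / (2 * m) + m / 2)"

lemma wtilde_huber:
  "wtilde S0 \<rho> X \<mu> = huber (\<mu> * \<rho>) (2 * \<rho> * norm (resid (psd_sqrt S0) X))"
  by (simp add: wtilde_def huber_def wfun_resid mult.assoc)

lemma huber_taylor:
  assumes m: "m > 0"
  shows "\<bar>huber m s' - huber m s - min 1 (s / m) * (s' - s)\<bar> \<le> (s' - s)\<^sup>2 / (2 * m)"
proof -
  have k: "min 1 (s / m) = (if s \<ge> m then 1 else s / m)" using m by (auto simp: min_def field_simps)
  consider "s \<ge> m" "s' \<ge> m" | "s \<ge> m" "s' < m" | "s < m" "s' \<ge> m" | "s < m" "s' < m" by linarith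
  then show ?thesis
  proof cases
    case 1
    then show ?thesis using m by (simp add: huber_def k)
  next
    case 2
    have "(m - s')\<^sup>2 \<le> (s' - s)\<^sup>2" using 2 by (intro abs_le_square_iff[THEN iffD1]) auto
    moreover have "huber m s' - huber m s - min 1 (s / m) * (s' - s) = (m - s')\<^sup>2 / (2 * m)"
      using 2 m by (simp add: huber_def k field_simps power2_eq_square)
    ultimately show ?thesis using m by (simp add: divide_right_mono)
  next
    case 3
    have "(s' - m)\<^sup>2 \<le> (s' - s)\<^sup>2" using 3 by (intro abs_le_square_iff[THEN iffD1]) auto
    moreover have "huber m s' - huber m s - min 1 (s / m) * (s' - s)
        = ((s' - s)\<^sup>2 - (s' - m)\<^sup>2) / (2 * m)"
      using 3 m by (simp add: huber_def k field_simps power2_eq_square)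
    ultimately show ?thesis using m by (simp add: divide_right_mono)
  next
    case 4
    then have "huber m s' - huber m s - min 1 (s / m) * (s' - s) = (s' - s)\<^sup>2 / (2 * m)"
      using m by (simp add: huber_def k field_simps power2_eq_square)
    then show ?thesis using m by simp
  qed
qed

lemma huber_has_derivative:
  assumes m: "m > 0"
  shows "(huber m has_derivative (\<lambda>h. min 1 (s / m) * h)) (at s)"
proof (rule has_derivativeI_sandwich[of 1])
  fix s' assume "s' \<noteq> s"
  then show "norm (huber m s' - huber m s - min 1 (s / m) * (s' - s)) / norm (s' - s)
      \<le> \<bar>s' - s\<bar> / (2 * m)"
    using huber_taylor[OF m, of s' s] by (simp add: divide_le_eq power2_eq_square mult_ac flip: abs_mult)
next
  have "((\<lambda>s'. \<bar>s' - s\<bar> / (2 * m)) \<longlongrightarrow> \<bar>s - s\<bar> / (2 * m)) (at s)"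
    using m by (intro tendsto_intros) auto
  then show "((\<lambda>s'. \<bar>s' - s\<bar> / (2 * m)) \<longlongrightarrow> 0) (at s)" by simp
qed (auto intro: bounded_linear_mult_right)

text \<open>At nonzero residual this is the chain rule. At zero residual the norm need not be
  differentiable, but the increment is bounded by a multiple of the squared norm of the residual,
  whose derivative vanishes there.\<close>

lemma has_rgrad_huber:
  fixes X :: "real^'r^'d"
  assumes X: "X \<in> stiefel" and m: "m > 0"
  shows "has_rgrad (\<lambda>Y. huber m (c * norm (resid R Y))) X
           (min 1 (c * norm (resid R X) / m) *\<^sub>R wgrad c R X)"
proof (cases "resid R X = 0")
  case False
  let ?f = "\<lambda>Y :: real^'r^'d. c * norm (resid R Y)"
  have g: "wgrad c R X \<in> tangent_space X"
    "(?f has_derivative (\<lambda>D. wgrad c R X \<bullet> D)) (at X within stiefel)"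
    using has_rgrad_norm_resid[OF X False, of c] by (auto simp: has_rgrad_def)
  show ?thesis
    using has_derivative_compose[OF g(2) huber_has_derivative[OF m]] g(1)
    by (simp add: has_rgrad_def subspace_scale subspace_tangent_space)
next
  case True
  let ?q = "\<lambda>Y :: real^'r^'d. c\<^sup>2 / (2 * m) * (resid R Y \<bullet> resid R Y)"
  have "(?q has_derivative (\<lambda>D. c\<^sup>2 / (2 * m) *
      (resid R X \<bullet> (- (X ** transpose D + D ** transpose X) ** R)
        + (- (X ** transpose D + D ** transpose X) ** R) \<bullet> resid R X))) (at X within stiefel)"
    by (intro has_derivative_mult_right has_derivative_inner resid_has_derivative)
  then have "(?q has_derivative (\<lambda>_. 0)) (at X within stiefel)" by (simp add: True)
  then have lim: "((\<lambda>Y. norm (?q Y) / norm (Y - X)) \<longlongrightarrow> 0) (at X within stiefel)"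
    by (simp add: has_derivative_iff_norm True)
  have "((\<lambda>Y. huber m (c * norm (resid R Y))) has_derivative (\<lambda>_. 0)) (at X within stiefel)"
  proof (rule has_derivativeI_sandwich[of 1, OF _ _ _ lim])
    fix Y :: "real^'r^'d"
    have "\<bar>huber m (c * norm (resid R Y)) - huber m 0\<bar> \<le> (c * norm (resid R Y))\<^sup>2 / (2 * m)"
      using huber_taylor[OF m, of _ 0] by simp
    also have "\<dots> = norm (?q Y)"
      using m by (simp add: power_mult_distrib power2_norm_eq_inner)
    finally have "norm (huber m (c * norm (resid R Y)) - huber m (c * norm (resid R X)) - 0)
        \<le> norm (?q Y)" by (simp add: True)
    then show "norm (huber m (c * norm (resid R Y)) - huber m (c * norm (resid R X)) - 0)
        / norm (Y - X) \<le> norm (?q Y) / norm (Y - X)"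
      by (rule divide_right_mono) simp
  qed auto
  then show ?thesis by (simp add: has_rgrad_def True subspace_0 subspace_tangent_space)
qed

section \<open>Bounds and limits of gradients\<close>

text \<open>The division by the norm of the residual is compensated by the residual in the product.
  Gradients therefore stay bounded even as the residual tends to zero, so convergent subsequences
  exist.\<close>

lemma wgrad_bound:
  obtains K where "\<And>X :: real^'r^'d. norm (wgrad c R X) \<le> K * norm X"
proof -
  have "\<exists>K>0. \<forall>(a :: real^'d^'d) (b :: real^'r^'d). norm (a ** b) \<le> norm a * norm b * K"
    by (rule mm.pos_bounded)
  then obtain K where K: "K > 0"
    "norm (a ** b) \<le> norm a * norm b * K" for a :: "real^'d^'d" and b :: "real^'r^'d"
    by metis
  have "norm (wgrad c R X) \<le> (\<bar>c\<bar> * (norm (transpose R) * K * K)) * norm X" for X :: "real^'r^'d"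
  proof -
    let ?M = "resid R X"
    have "norm (?M ** (transpose R ** X)) \<le> norm ?M * norm (transpose R ** X) * K"
      by (rule K)
    also have "\<dots> \<le> norm ?M * (norm (transpose R) * norm X * K) * K"
      using K(1) by (intro mult_right_mono mult_left_mono K) auto
    finally have "norm (?M ** (transpose R ** X)) \<le> norm ?M * (norm (transpose R) * norm X * K * K)"
      by (simp add: mult_ac)
    then have "\<bar>c\<bar> / norm ?M * norm (?M ** (transpose R ** X))
        \<le> \<bar>c\<bar> / norm ?M * (norm ?M * (norm (transpose R) * norm X * K * K))"
      by (intro mult_left_mono) auto
    then have "norm (wgrad c R X) \<le>
        \<bar>c\<bar> / norm ?M * (norm ?M * (norm (transpose R) * norm X * K * K))"
      by (simp add: wgrad_def)
    also have "\<dots> \<le> \<bar>c\<bar> * (norm (transpose R) * norm X * K * K)"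
      using K(1) by (cases "?M = 0") auto
    finally show ?thesis by (simp add: mult_ac)
  qed
  then show ?thesis by (rule that)
qed

text \<open>Kept apart from its convex hull because \<open>D\<close> and \<open>- D\<close> are both
  placed in this set before convexity is used.\<close>

definition limiting_rgrads :: "(real^'r^'d \<Rightarrow> real) \<Rightarrow> real^'r^'d \<Rightarrow> (real^'r^'d) set" where
  "limiting_rgrads F X = {D \<in> tangent_space X. \<exists>Xs :: nat \<Rightarrow> real^'r^'d.
     (\<forall>t. Xs t \<in> rdiff_points F) \<and> Xs \<longlonglongrightarrow> X \<and> (\<lambda>t. rgrad F (Xs t)) \<longlonglongrightarrow> D}"

lemma clarke_subdiff_eq: "clarke_subdiff F X = convex hull limiting_rgrads F X"
  by (simp add: clarke_subdiff_def limiting_rgrads_def)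

lemma transpose_mult_limit:
  assumes "\<And>t. Xs t \<in> stiefel" "Xs \<longlonglongrightarrow> X" "(\<lambda>t. wgrad c R (Xs t)) \<longlonglongrightarrow> D"
  shows "transpose X ** D = 0"
proof -
  have "(\<lambda>t. transpose (Xs t) ** wgrad c R (Xs t)) \<longlonglongrightarrow> transpose X ** D"
    by (intro mm.tendsto bounded_linear.tendsto[OF bounded_linear_transpose] assms)
  then have "(\<lambda>t. 0) \<longlonglongrightarrow> transpose X ** D" by (simp add: transpose_mult_wgrad assms(1))
  then show ?thesis by (simp add: LIMSEQ_const_iff)
qed

lemma limiting_rgradsI:
  assumes Xs: "\<And>t. Xs t \<in> stiefel" "Xs \<longlonglongrightarrow> X" "(\<lambda>t. wgrad c R (Xs t)) \<longlonglongrightarrow> D"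
    and ev: "eventually (\<lambda>t. resid R (Xs t) \<noteq> 0) sequentially"
  shows "D \<in> limiting_rgrads (\<lambda>Y. c * norm (resid R Y)) X"
proof -
  obtain N where N: "\<And>t. t \<ge> N \<Longrightarrow> resid R (Xs t) \<noteq> 0"
    using ev by (auto simp: eventually_sequentially)
  let ?F = "\<lambda>Y. c * norm (resid R Y)"
  \<comment> \<open>Differentiability is required at every index, but nonzero residuals are known
    only from \<open>N\<close> on, so the sequence is shifted.\<close>
  define Ys where "Ys = (\<lambda>t. Xs (t + N))"
  have g: "has_rgrad ?F (Ys t) (wgrad c R (Ys t))" for t
    unfolding Ys_def by (intro has_rgrad_norm_resid Xs N) simp
  have "Ys t \<in> rdiff_points ?F" for t
    using g Xs(1) by (auto simp: rdiff_points_def Ys_def)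
  moreover have "Ys \<longlonglongrightarrow> X"
    unfolding Ys_def by (rule LIMSEQ_ignore_initial_segment[OF Xs(2)])
  moreover have "(\<lambda>t. wgrad c R (Ys t)) \<longlonglongrightarrow> D"
    unfolding Ys_def by (rule LIMSEQ_ignore_initial_segment[OF Xs(3)])
  moreover have "rgrad ?F (Ys t) = wgrad c R (Ys t)" for t
    using g Xs(1) by (intro rgrad_eqI) (auto simp: Ys_def)
  moreover have "D \<in> tangent_space X"
    by (rule tangent_spaceI[OF transpose_mult_limit[OF Xs]])
  ultimately show ?thesis unfolding limiting_rgrads_def by (auto intro!: exI[of _ Ys])
qed

section \<open>The reflection symmetry at a zero of the residual\<close>

text \<open>The reflected points \<open>Q ** Xs t\<close> stay on the manifold and still tend to
  \<open>X\<close>. Their gradients are the reflected gradients, which tend to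
  \<open>Q ** D = - D\<close>.\<close>

lemma limiting_rgrads_uminus:
  fixes X :: "real^'r^'d"
  assumes X: "X \<in> stiefel" "resid R X = 0"
    and Xs: "\<And>t. Xs t \<in> stiefel" "Xs \<longlonglongrightarrow> X" "(\<lambda>t. wgrad c R (Xs t)) \<longlonglongrightarrow> D"
    and ev: "eventually (\<lambda>t. resid R (Xs t) \<noteq> 0) sequentially"
  shows "- D \<in> limiting_rgrads (\<lambda>Y. c * norm (resid R Y)) X"
proof -
  define P where "P = X ** transpose X"
  define Q where "Q = 2 *\<^sub>R P - mat 1"
  have XX: "transpose X ** X = mat 1" using X by (simp add: stiefel_def)
  \<comment> \<open>Zero residual says that the columns of \<open>R\<close> lie in the column space
    of \<open>X\<close>, onto which \<open>P\<close> projects.\<close>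
  have PR: "P ** R = R" using X(2) by (simp add: resid_def P_def mm.diff_left)
  have PX: "P ** X = X" by (simp add: P_def XX flip: matrix_mul_assoc)
  then have PP: "P ** P = P" unfolding P_def by (simp add: matrix_mul_assoc)
  have tQ: "transpose Q = Q"
    by (simp add: Q_def P_def transpose_diff transpose_scalar matrix_transpose_mul)
  have QP: "Q ** P = P" by (simp add: Q_def mm.diff_left mm.scaleR_left PP) (simp add: scaleR_2)
  have "Q ** Q = 2 *\<^sub>R (Q ** P) - Q"
    by (subst (2) Q_def) (simp add: mm.diff_right mm.scaleR_right)
  then have QQ: "Q ** Q = mat 1" by (simp add: QP) (simp add: Q_def)
  have QX: "Q ** X = X" by (simp add: Q_def mm.diff_left mm.scaleR_left PX) (simp add: scaleR_2)
  have QR: "Q ** R = R" by (simp add: Q_def mm.diff_left mm.scaleR_left PR) (simp add: scaleR_2)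
  have RQ: "transpose R ** Q = transpose R"
    using arg_cong[OF QR, of transpose] by (simp add: matrix_transpose_mul tQ)
  have norm_Q: "norm (Q ** A) = norm A" for A :: "real^'d^'d"
    unfolding norm_eq_sqrt_inner by (simp add: inner_matrix_mult_left tQ matrix_mul_assoc QQ)
  \<comment> \<open>\<open>Q ** R = R\<close> enters twice: to absorb the inner \<open>Q\<close>
    next to \<open>R\<close>, and to write the leading \<open>R\<close> as \<open>Q ** R\<close> so
    that \<open>Q\<close> factors out.\<close>
  have rQ: "resid R (Q ** Y) = Q ** resid R Y" for Y :: "real^'r^'d"
  proof -
    have "resid R (Q ** Y) = R - Q ** (Y ** (transpose Y ** (Q ** R)))"
      by (simp add: resid_def mm.diff_left matrix_transpose_mul tQ matrix_mul_assoc)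
    also have "\<dots> = Q ** R - Q ** (Y ** (transpose Y ** R))" by (simp add: QR)
    also have "\<dots> = Q ** resid R Y"
      by (simp add: resid_def mm.diff_left mm.diff_right matrix_mul_assoc)
    finally show ?thesis .
  qed
  have gQ: "wgrad c R (Q ** Y) = Q ** wgrad c R Y" for Y :: "real^'r^'d"
  proof -
    have "transpose R ** (Q ** Y) = transpose R ** Y" by (simp add: matrix_mul_assoc RQ)
    then have "(Q ** resid R Y) ** (transpose R ** (Q ** Y)) = Q ** (resid R Y ** (transpose R ** Y))"
      by (simp flip: matrix_mul_assoc)
    then show ?thesis by (simp add: wgrad_def rQ norm_Q mm.scaleR_right mm.minus_right)
  qed
  have "P ** D = 0"
    using transpose_mult_limit[OF Xs] by (simp add: P_def matrix_mul_assoc[symmetric])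
  then have QD: "Q ** D = - D" by (simp add: Q_def mm.diff_left mm.scaleR_left)
  show ?thesis
  proof (rule limiting_rgradsI)
    show "Q ** Xs t \<in> stiefel" for t
    proof -
      have "transpose (Q ** Xs t) ** (Q ** Xs t) = transpose (Xs t) ** ((Q ** Q) ** Xs t)"
        by (simp add: matrix_transpose_mul tQ matrix_mul_assoc)
      then show ?thesis using Xs(1)[of t] by (simp add: QQ stiefel_def)
    qed
    show "(\<lambda>t. Q ** Xs t) \<longlonglongrightarrow> X"
      using mm.tendsto[OF tendsto_const[of Q] Xs(2)] by (simp add: QX)
    show "(\<lambda>t. wgrad c R (Q ** Xs t)) \<longlonglongrightarrow> - D"
      using mm.tendsto[OF tendsto_const[of Q] Xs(3)] by (simp add: QD gQ)
    show "eventually (\<lambda>t. resid R (Q ** Xs t) \<noteq> 0) sequentially"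
      using ev
    proof (rule eventually_mono)
      show "resid R (Q ** Xs t) \<noteq> 0" if "resid R (Xs t) \<noteq> 0" for t
        using that norm_Q[of "resid R (Xs t)"] by (auto simp: rQ)
    qed
  qed
qed

section \<open>Membership in the Clarke subdifferential at a zero of the residual\<close>

lemma bounded_range_wgrad:
  fixes X :: "real^'r^'d"
  assumes "Xs \<longlonglongrightarrow> X"
  shows "bounded (range (\<lambda>t :: nat. wgrad c R (Xs t)))"
proof -
  obtain K where K: "\<And>X :: real^'r^'d. norm (wgrad c R X) \<le> K * norm X" using wgrad_bound by blast
  obtain B where B: "\<And>t. norm (Xs t) \<le> B"
    using convergent_imp_bounded[OF assms] by (auto simp: bounded_iff)
  have "norm (wgrad c R (Xs t)) \<le> \<bar>K\<bar> * B" for t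
  proof -
    have "norm (wgrad c R (Xs t)) \<le> \<bar>K\<bar> * norm (Xs t)"
      by (rule order_trans[OF K]) (simp add: mult_right_mono)
    also have "\<dots> \<le> \<bar>K\<bar> * B" by (intro mult_left_mono B) auto
    finally show ?thesis .
  qed
  then show ?thesis by (auto simp: bounded_iff)
qed

text \<open>Along a suitable subsequence the factors and the gradients converge separately, so
  \<open>G\<close> is a multiple of a limiting gradient \<open>D\<close> by a number in the unit
  interval. It then lies on the segment from \<open>- D\<close> to \<open>D\<close>.\<close>

lemma scaled_limit_mem_clarke:
  assumes X: "X \<in> stiefel" "resid R X = 0"
    and Xs: "\<And>t. Xs t \<in> stiefel" "Xs \<longlonglongrightarrow> X"
    and ev: "eventually (\<lambda>t. resid R (Xs t) \<noteq> 0) sequentially"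
    and k: "\<And>t. 0 \<le> k t" "\<And>t. k t \<le> 1"
    and G: "(\<lambda>t. k t *\<^sub>R wgrad c R (Xs t)) \<longlonglongrightarrow> G"
  shows "G \<in> clarke_subdiff (\<lambda>Y. c * norm (resid R Y)) X"
proof -
  have "bounded (range k)" using k by (auto simp: bounded_iff intro!: exI[of _ 1])
  \<comment> \<open>Only the products are known to converge. Boundedness of the pairs gives one
    subsequence that serves both components.\<close>
  then have "bounded (range k \<times> range (\<lambda>t. wgrad c R (Xs t)))"
    by (intro bounded_Times bounded_range_wgrad[OF Xs(2)])
  then have "bounded (range (\<lambda>t. (k t, wgrad c R (Xs t))))"
    by (rule bounded_subset) auto
  then obtain l r where r: "strict_mono r" and
    l: "((\<lambda>t. (k t, wgrad c R (Xs t))) \<circ> r) \<longlonglongrightarrow> l"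
    using bounded_imp_convergent_subsequence by blast
  define \<kappa> D where "\<kappa> = fst l" and "D = snd l"
  have kr: "(\<lambda>t. k (r t)) \<longlonglongrightarrow> \<kappa>"
    using tendsto_fst[OF l] by (simp add: \<kappa>_def o_def)
  have Dr: "(\<lambda>t. wgrad c R (Xs (r t))) \<longlonglongrightarrow> D"
    using tendsto_snd[OF l] by (simp add: D_def o_def)
  have "(\<lambda>t. k (r t) *\<^sub>R wgrad c R (Xs (r t))) \<longlonglongrightarrow> G"
    using LIMSEQ_subseq_LIMSEQ[OF G r] by (simp add: o_def)
  then have GD: "G = \<kappa> *\<^sub>R D"
    by (rule LIMSEQ_unique[OF _ tendsto_scaleR[OF kr Dr]])
  have \<kappa>: "0 \<le> \<kappa>" "\<kappa> \<le> 1"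
    by (rule LIMSEQ_le_const[OF kr], simp add: k) (rule LIMSEQ_le_const2[OF kr], simp add: k)
  have Xr: "(\<lambda>t. Xs (r t)) \<longlonglongrightarrow> X"
    using LIMSEQ_subseq_LIMSEQ[OF Xs(2) r] by (simp add: o_def)
  have evr: "eventually (\<lambda>t. resid R (Xs (r t)) \<noteq> 0) sequentially"
    by (rule eventually_subseq[OF r ev])
  let ?L = "limiting_rgrads (\<lambda>Y. c * norm (resid R Y)) X"
  have "D \<in> convex hull ?L" "- D \<in> convex hull ?L"
    using limiting_rgradsI[OF Xs(1) Xr Dr evr] limiting_rgrads_uminus[OF X Xs(1) Xr Dr evr]
    by (simp_all add: hull_inc)
  \<comment> \<open>The weights are nonnegative with sum 1 and difference
    \<open>\<kappa>\<close>.\<close>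
  then have "((1 + \<kappa>) / 2) *\<^sub>R D + ((1 - \<kappa>) / 2) *\<^sub>R (- D) \<in> convex hull ?L"
    using \<kappa> by (intro convexD[OF convex_convex_hull]) (auto simp: field_simps)
  moreover have "((1 + \<kappa>) / 2) *\<^sub>R D + ((1 - \<kappa>) / 2) *\<^sub>R (- D) = ((1 + \<kappa>) / 2 - (1 - \<kappa>) / 2) *\<^sub>R D"
    by (simp add: scaleR_diff_left)
  moreover have "(1 + \<kappa>) / 2 - (1 - \<kappa>) / 2 = \<kappa>" by (simp add: field_simps)
  ultimately show ?thesis by (simp add: GD clarke_subdiff_eq)
qed

text \<open>A zero limit of smoothed gradients says nothing about the residuals along the sequence,
  so \<open>0\<close> is treated on its own. Either the residual vanishes on the manifold near
  \<open>X\<close>, or points of nonzero residual accumulate at \<open>X\<close>.\<close>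

lemma zero_mem_clarke:
  fixes X :: "real^'r^'d"
  assumes X: "X \<in> stiefel" "resid R X = 0"
  shows "0 \<in> clarke_subdiff (\<lambda>Y. c * norm (resid R Y)) X"
proof (cases "\<exists>e>0. \<forall>Y\<in>stiefel. dist Y X < e \<longrightarrow> resid R Y = 0")
  case True
  let ?F = "\<lambda>Y :: real^'r^'d. c * norm (resid R Y)"
  obtain e where e: "e > 0" "\<And>Y. Y \<in> stiefel \<Longrightarrow> dist Y X < e \<Longrightarrow> resid R Y = 0"
    using True by auto
  have "(?F has_derivative (\<lambda>_. 0)) (at X within stiefel)"
    by (rule has_derivative_transform_within[OF has_derivative_const[of 0] e(1) X(1)]) (simp add: e)
  then have g: "has_rgrad ?F X 0"
    by (simp add: has_rgrad_def subspace_0 subspace_tangent_space)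
  then have "X \<in> rdiff_points ?F" using X(1) by (auto simp: rdiff_points_def)
  then have "0 \<in> limiting_rgrads ?F X"
    using rgrad_eqI[OF X(1) g] unfolding limiting_rgrads_def
    by (auto simp: subspace_0 subspace_tangent_space intro!: exI[of _ "\<lambda>_. X"])
  then show ?thesis by (simp add: clarke_subdiff_eq hull_inc)
next
  case False
  then have far: "\<exists>Y. Y \<in> stiefel \<and> dist Y X < e \<and> resid R Y \<noteq> 0" if "e > 0" for e
    using that by blast
  have step: "\<exists>Y. Y \<in> stiefel \<and> dist Y X < inverse (real (Suc t)) \<and> resid R Y \<noteq> 0" for t
    by (rule far) simp
  have "\<exists>Xs. \<forall>t. Xs t \<in> stiefel \<and> dist (Xs t) X < inverse (real (Suc t)) \<and> resid R (Xs t) \<noteq> 0"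
    by (rule choice, rule allI, rule step)
  then obtain Xs where
    "\<forall>t. Xs t \<in> stiefel \<and> dist (Xs t) X < inverse (real (Suc t)) \<and> resid R (Xs t) \<noteq> 0" ..
  then have Xs: "Xs t \<in> stiefel" "dist (Xs t) X \<le> inverse (real (Suc t))" "resid R (Xs t) \<noteq> 0" for t
    by (simp_all add: less_imp_le)
  have "(\<lambda>t. dist (Xs t) X) \<longlonglongrightarrow> 0"
    using Xs(2) by (intro tendsto_sandwich[OF _ _ tendsto_const LIMSEQ_inverse_real_of_nat]
        always_eventually allI) simp_all
  then have "Xs \<longlonglongrightarrow> X" by (rule tendsto_dist_iff[THEN iffD2])
  \<comment> \<open>With all factors equal to 0 the scaled gradients converge trivially to 0,
    whether or not the gradients themselves converge.\<close>
  then show ?thesis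
    by (rule scaled_limit_mem_clarke[OF X Xs(1), where k = "\<lambda>_. 0"]) (auto simp: Xs(3))
qed

section \<open>The inclusion of the subdifferentials\<close>

theorem mainTheorem8:
  fixes S0 :: "real^'d^'d" and \<rho> :: real and X :: "real^'r^'d"
  assumes "CARD('r) < CARD('d)"
    and "psd S0"
    and "0 < \<rho>"
    and "X \<in> stiefel"
  shows "smoothing_subdiff (wtilde S0 \<rho>) X \<subseteq> clarke_subdiff (wfun S0 \<rho>) X"
proof
  fix G assume "G \<in> smoothing_subdiff (wtilde S0 \<rho>) X"
  then obtain Xs \<mu>s where Xs: "\<And>t. Xs t \<in> stiefel" "Xs \<longlonglongrightarrow> X"
    and \<mu>: "\<And>t. 0 < \<mu>s t" "\<mu>s \<longlonglongrightarrow> 0"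
    and G: "(\<lambda>t. rgrad (\<lambda>Y. wtilde S0 \<rho> Y (\<mu>s t)) (Xs t)) \<longlonglongrightarrow> G"
    unfolding smoothing_subdiff_def by blast
  define R where "R = psd_sqrt S0"
  define c where "c = 2 * \<rho>"
  define k where "k = (\<lambda>t. min 1 (c * norm (resid R (Xs t)) / (\<mu>s t * \<rho>)))"
  have c: "c > 0" using assms(3) by (simp add: c_def)
  have w: "wfun S0 \<rho> = (\<lambda>Y :: real^'r^'d. c * norm (resid R Y))"
    by (simp add: fun_eq_iff wfun_resid c_def R_def)
  have "rgrad (\<lambda>Y. wtilde S0 \<rho> Y (\<mu>s t)) (Xs t) = k t *\<^sub>R wgrad c R (Xs t)" for t
    unfolding wtilde_huber k_def c_def R_def
    using assms(3) \<mu>(1) by (intro rgrad_eqI Xs has_rgrad_huber) simp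
  then have G: "(\<lambda>t. k t *\<^sub>R wgrad c R (Xs t)) \<longlonglongrightarrow> G" using G by simp
  have k: "0 \<le> k t" "k t \<le> 1" for t
    using c assms(3) \<mu>(1)[of t] by (auto simp: k_def)
  show "G \<in> clarke_subdiff (wfun S0 \<rho>) X"
  proof (cases "resid R X = 0")
    case True
    show ?thesis
    proof (cases "G = 0")
      case False
      \<comment> \<open>A nonzero limit forces nonzero terms, and these rule out zero residuals
        because \<open>wgrad\<close> is 0 there by the convention for division by zero.\<close>
      have "eventually (\<lambda>t. k t *\<^sub>R wgrad c R (Xs t) \<noteq> 0) sequentially"
        by (rule tendsto_imp_eventually_ne[OF G False])
      then have "eventually (\<lambda>t. resid R (Xs t) \<noteq> 0) sequentially"
        by (rule eventually_mono) (auto simp: wgrad_def)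
      then show ?thesis
        unfolding w by (rule scaled_limit_mem_clarke[OF assms(4) True Xs _ k G])
    qed (simp add: w zero_mem_clarke assms(4) True)
  next
    case False
    have resid_lim: "(\<lambda>t. resid R (Xs t)) \<longlonglongrightarrow> resid R X"
      using continuous_on_tendsto_compose[OF continuous_on_resid[of UNIV] Xs(2)] by simp
    \<comment> \<open>The threshold \<open>\<mu>s t * \<rho>\<close> tends to 0 while
      \<open>w\<close> keeps a positive limit, so the smoothing is eventually inactive at
      \<open>Xs t\<close>.\<close>
    have "(\<lambda>t. c * norm (resid R (Xs t)) - \<mu>s t * \<rho>) \<longlonglongrightarrow> c * norm (resid R X) - 0 * \<rho>"
      by (intro tendsto_intros resid_lim \<mu>)
    then have "eventually (\<lambda>t. c * norm (resid R (Xs t)) - \<mu>s t * \<rho> > 0) sequentially"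
      by (rule order_tendstoD) (use c False in simp)
    then have "eventually (\<lambda>t. k t *\<^sub>R wgrad c R (Xs t) = wgrad c R (Xs t)) sequentially"
      using \<mu>(1) assms(3) by (elim eventually_mono) (simp add: k_def)
    then have "(\<lambda>t. wgrad c R (Xs t)) \<longlonglongrightarrow> G"
      using G by (simp add: tendsto_cong)
    moreover have "eventually (\<lambda>t. resid R (Xs t) \<noteq> 0) sequentially"
      by (rule tendsto_imp_eventually_ne[OF resid_lim False])
    ultimately show ?thesis
      using limiting_rgradsI[OF Xs] by (simp add: w clarke_subdiff_eq hull_inc)
  qed
qed

end
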